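(* Let $F$, $H$, $W$ (or $\mathbf W$ if $m>1$) satisfy the standing assumptions listed in the context, including the comparison principle, and let $u_0\in BUC(\mathbb R^d)$. Consider the initial value problem $$du = F(D^2u,Du,u,x,t)\,dt+\sum_{i=1}^m H^i(Du,x)\cdot dW^i \ \text{ in } \mathbb R^d\times(0,T],\qquad u(\cdot,0)=u_0 \ \text{ on } \mathbb R^d .$$ Then there exists at most one (pathwise viscosity) solution of the initial value problem in $BUC(\mathbb R^d\times[0,T])$, which is given by the maximal sub-solution (or minimal super-solution) of the initial value problem.
   Context: Notation. $S^d$ is the space of symmetric $d\times d$ matrices with its usual order; $BUC$, $USC$, $LSC$ denote bounded uniformly continuous, upper-semicontinuous and lower-semicontinuous functions; $C^k_b(\Omega)$ is the space of functions with bounded continuous derivatives through order $k$. Intervals $(t_0-h,t_0+h)$ are understood to be intersected with $[0,T]$. Standing assumptions. $T>0$, $d,m\ge 1$. (1) $F:S^d\times\mathbb R^d\times\mathbb R\times\mathbb R^d\times[0,T]\to\mathbb R$, $F=F(X,p,r,x,t)$, is continuous, bounded on $\{(X,p,r)\in B\}\times\mathbb R^d\times[0,T]$ for every bounded set $B$, nondecreasing in $X$, nonincreasing in $r$. (2) $H=(H^1,\dots,H^m):\mathbb R^d\times\mathbb R^d\to\mathbb R^m$, $H=H(p,x)$; if $m=1$, $H\in C^2_b(B_R(0)\times\mathbb R^d)$ for all $R>0$; if $m>1$, $H\in C^4_b(\mathbb R^d\times\mathbb R^d;\mathbb R^m)$. (3) $W\in C([0,T],\mathbb R^m)$, $W(0)=0$;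 if $m>1$, there are $\alpha\in(\frac13,\frac12]$ and $\mathbb W:[0,T]^2\to\mathbb R^m\otimes\mathbb R^m$ such that $\mathbf W=(W,\mathbb W)$ is an $\alpha$-Hölder geometric rough path: $\sup_{s\neq t}\frac{|W_s-W_t|}{|s-t|^\alpha}+\sup_{s\ne t}\frac{|\mathbb W_{st}|}{|s-t|^{2\alpha}}<\infty$, $\mathbb W_{st}-\mathbb W_{su}-\mathbb W_{ut}=(W_u-W_s)\otimes(W_t-W_u)$, and the symmetric part of $\mathbb W_{st}$ equals $\frac12(W_t-W_s)\otimes(W_t-W_s)$. Differential equations and integrals against $dW$ are then in the rough path sense. (4) Comparison principle (assumed): if $u\in USC(\mathbb R^d\times[0,T])$ and $v\in LSC(\mathbb R^d\times[0,T])$ are respectively a sub- and a super-solution (defined below), then for all $t\in(0,T]$, $\sup_{x}(u(x,t)-v(x,t))_+\le\sup_x(u(x,0)-v(x,0))_+$. Solution operator. For $t_0\in[0,T]$ let $(X,P)(x,p,t)$ solve $dX=-\sum_i D_pH^i(P,X)\cdot dW^i$, $dP=\sum_i D_xH^i(P,X)\cdot dW^i$, $X(x,p,t_0)=x$, $P(x,p,t_0)=p$. When $m=1$ this means $(X,P)(x,p,t)=(\tilde X,\tilde P)(x,p,W_t-W_{t_0})$, where $\frac{d}{d\tau}\tilde X=-D_pH(\tilde P,\tilde X)$, $\frac{d}{d\tau}\tilde P=D_xH(\tilde P,\tilde X)$, $(\tilde X,\tilde P)(x,p,0)=(x,p)$. For $\phi\in C^2_b(\mathbb R^d)$ set $\mathbf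 X(x,t)=X(x,D\phi(x),t)$, $\mathbf P(x,t)=P(x,D\phi(x),t)$, and $\mathbf Z(x,t)=\phi(x)+\sum_i\int_{t_0}^t(H^i(\mathbf P,\mathbf X)-\mathbf P\cdot D_pH^i(\mathbf P,\mathbf X))(x,s)\cdot dW^i_s$ (when $m=1$: $\mathbf Z(x,t)=\phi(x)+\int_0^{W_t-W_{t_0}}(H(\tilde P,\tilde X)-\tilde P\cdot D_pH(\tilde P,\tilde X))(x,D\phi(x),\tau)\,d\tau$). For all sufficiently small $h>0$ and $t\in(t_0-h,t_0+h)$, $x\mapsto\mathbf X(x,t)$ is a bijection of $\mathbb R^d$, it and its inverse being $C^1$ with bounded first derivatives and depending continuously on $t$; for such $h$ one defines $S(t,t_0)\phi(x):=\mathbf Z(\mathbf X^{-1}(x,t),t)$, which lies in $C^2_b(\mathbb R^d)$. "$S(t,t_0)\phi\in C^2_b(\mathbb R^d)$ for $t\in(t_0-h,t_0+h)$" means that $h$ is small in this sense. Definition of solutions. $u\in USC(\mathbb R^d\times[0,T])$ (resp. $LSC$) is a (pathwise viscosity) sub-solution (resp. super-solution) of the initial value problem if $u$ is bounded from above (resp. below), $u(\cdot,0)\le u_0$ (resp. $\ge u_0$), and whenever $t_0\in(0,T]$, $\phi\in C^2_b(\mathbb R^d)$, $\psi\in C^1([0,T])$, $h>0$, $S(t,t_0)\phi\in C^2_b(\mathbb R^d)$ for $t\in(t_0-h,t_0+h)$, and $u(x,t)-S(t,t_0)\phi(x)-\psi(t)$ attains a local maximum (resp. minimum) at $(x_0,t_0)$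 in $\mathbb R^d\times(t_0-h,t_0+h)$, then $\psi'(t_0)\le F(D^2\phi(x_0),D\phi(x_0),u(x_0,t_0),x_0,t_0)$ (resp. $\ge$). A solution is both a sub- and a super-solution. *)

theory Defs
  imports "HOL-Analysis.Analysis"
begin

section \<open>Function spaces, semicontinuity, matrices\<close>

text \<open>\<open>Ckb k \<Omega> f\<close>: on the open set \<open>\<Omega>\<close>, all partial derivatives of \<open>f\<close> of order at most \<open>k\<close> exist,
  are continuous and bounded.\<close>

primrec Ckb :: "nat \<Rightarrow> 'a::euclidean_space set \<Rightarrow> ('a \<Rightarrow> 'b::real_normed_vector) \<Rightarrow> bool" where
  "Ckb 0 \<Omega> f \<longleftrightarrow> continuous_on \<Omega> f \<and> bounded (f ` \<Omega>)"
| "Ckb (Suc k) \<Omega> f \<longleftrightarrow> continuous_on \<Omega> f \<and> bounded (f ` \<Omega>) \<and> (\<forall>z\<in>\<Omega>. f differentiable (at z)) \<and>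
     (\<forall>b\<in>Basis. Ckb k \<Omega> (\<lambda>z. frechet_derivative f (at z) b))"

definition C1_bounded_deriv :: "('a::euclidean_space \<Rightarrow> 'b::real_normed_vector) \<Rightarrow> bool" where
  "C1_bounded_deriv f \<longleftrightarrow> (\<forall>z. f differentiable (at z)) \<and>
     (\<forall>b\<in>Basis. Ckb 0 UNIV (\<lambda>z. frechet_derivative f (at z) b))"

definition BUC :: "'a::metric_space set \<Rightarrow> ('a \<Rightarrow> real) \<Rightarrow> bool" where
  "BUC A f \<longleftrightarrow> bounded (f ` A) \<and> uniformly_continuous_on A f"

definition usc_on :: "'a::topological_space set \<Rightarrow> ('a \<Rightarrow> real) \<Rightarrow> bool" where
  "usc_on A f \<longleftrightarrow> (\<forall>z\<in>A. \<forall>c>f z. \<forall>\<^sub>F w in at z within A. f w < c)"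

definition lsc_on :: "'a::topological_space set \<Rightarrow> ('a \<Rightarrow> real) \<Rightarrow> bool" where
  "lsc_on A f \<longleftrightarrow> (\<forall>z\<in>A. \<forall>c<f z. \<forall>\<^sub>F w in at z within A. c < f w)"

definition local_max_on :: "'a::topological_space set \<Rightarrow> ('a \<Rightarrow> real) \<Rightarrow> 'a \<Rightarrow> bool" where
  "local_max_on A f z \<longleftrightarrow> z \<in> A \<and> (\<exists>U. open U \<and> z \<in> U \<and> (\<forall>w\<in>U \<inter> A. f w \<le> f z))"

definition local_min_on :: "'a::topological_space set \<Rightarrow> ('a \<Rightarrow> real) \<Rightarrow> 'a \<Rightarrow> bool" where
  "local_min_on A f z \<longleftrightarrow> z \<in> A \<and> (\<exists>U. open U \<and> z \<in> U \<and> (\<forall>w\<in>U \<inter> A. f z \<le> f w))"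

definition gradient :: "(real^'d \<Rightarrow> real) \<Rightarrow> real^'d \<Rightarrow> real^'d" where
  "gradient f x = (\<chi> i. frechet_derivative f (at x) (axis i 1))"

definition hessian :: "(real^'d \<Rightarrow> real) \<Rightarrow> real^'d \<Rightarrow> real^'d^'d" where
  "hessian f x = jacobian (gradient f) (at x)"

definition sym_matrices :: "(real^'d^'d) set" where
  "sym_matrices = {A. transpose A = A}"

definition matrix_le :: "real^'d^'d \<Rightarrow> real^'d^'d \<Rightarrow> bool" where
  "matrix_le A B \<longleftrightarrow> (\<forall>v. v \<bullet> (A *v v) \<le> v \<bullet> (B *v v))"

definition outer :: "real^'m \<Rightarrow> real^'m \<Rightarrow> real^'m^'m" where
  "outer a b = (\<chi> j i. a $ j * b $ i)"


section \<open>Rough paths, rough integrals\<close>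

definition geometric_rough_path ::
  "real \<Rightarrow> real \<Rightarrow> (real \<Rightarrow> real^'m) \<Rightarrow> (real \<Rightarrow> real \<Rightarrow> real^'m^'m) \<Rightarrow> bool" where
  "geometric_rough_path T \<alpha> W WW \<longleftrightarrow>
     (\<exists>C. \<forall>s\<in>{0..T}. \<forall>t\<in>{0..T}. s \<noteq> t \<longrightarrow>
        norm (W s - W t) / \<bar>s - t\<bar> powr \<alpha> \<le> C \<and> norm (WW s t) / \<bar>s - t\<bar> powr (2 * \<alpha>) \<le> C) \<and>
     (\<forall>s\<in>{0..T}. \<forall>u\<in>{0..T}. \<forall>t\<in>{0..T}.
        WW s t - WW s u - WW u t = outer (W u - W s) (W t - W u)) \<and>
     (\<forall>s\<in>{0..T}. \<forall>t\<in>{0..T}.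
        (1/2) *\<^sub>R (WW s t + transpose (WW s t)) = (1/2) *\<^sub>R outer (W t - W s) (W t - W s))"

text \<open>Controlled paths in the sense of Gubinelli: \<open>Y' s j\<close> is the coefficient of the
  \<open>j\<close>-th component of \<open>W\<close> in the expansion of \<open>Y\<close> at \<open>s\<close>.\<close>

definition controlled_path ::
  "real \<Rightarrow> real \<Rightarrow> (real \<Rightarrow> real^'m) \<Rightarrow> (real \<Rightarrow> 'b::real_normed_vector) \<Rightarrow> (real \<Rightarrow> 'm \<Rightarrow> 'b) \<Rightarrow> bool"
  where
  "controlled_path T \<alpha> W Y Y' \<longleftrightarrow>
     (\<exists>C. \<forall>s\<in>{0..T}. \<forall>t\<in>{0..T}.
        (\<forall>j. norm (Y' t j - Y' s j) \<le> C * \<bar>t - s\<bar> powr \<alpha>) \<and>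
        norm (Y t - Y s - (\<Sum>j\<in>UNIV. (W t - W s) $ j *\<^sub>R Y' s j)) \<le> C * \<bar>t - s\<bar> powr (2 * \<alpha>))"

text \<open>Compensated Riemann sum, along the partition \<open>\<tau> 0 < \<dots> < \<tau> n\<close>, of the rough integral of
  \<open>\<Sum>i. A i dW i\<close>, where \<open>A' s j i\<close> is the Gubinelli derivative of the integrand \<open>A s i\<close> in the
  direction \<open>j\<close>. The entry \<open>WW s t $ j $ i\<close> stands for the integral of \<open>(W r - W s) $ j\<close> against
  \<open>dW i\<close> over \<open>[s, t]\<close>; this is the index convention of Chen's relation in
  \<open>geometric_rough_path\<close>.\<close>

definition rough_sum ::
  "(real \<Rightarrow> real^'m) \<Rightarrow> (real \<Rightarrow> real \<Rightarrow> real^'m^'m) \<Rightarrow>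
   (real \<Rightarrow> 'm \<Rightarrow> 'b::real_normed_vector) \<Rightarrow> (real \<Rightarrow> 'm \<Rightarrow> 'm \<Rightarrow> 'b) \<Rightarrow> (nat \<Rightarrow> real) \<Rightarrow> nat \<Rightarrow> 'b" where
  "rough_sum W WW A A' \<tau> n =
     (\<Sum>k<n. (\<Sum>i\<in>UNIV. (W (\<tau> (Suc k)) - W (\<tau> k)) $ i *\<^sub>R A (\<tau> k) i) +
             (\<Sum>j\<in>UNIV. \<Sum>i\<in>UNIV. (WW (\<tau> k) (\<tau> (Suc k)) $ j $ i) *\<^sub>R A' (\<tau> k) j i))"

definition rough_sums_converge ::
  "(real \<Rightarrow> real^'m) \<Rightarrow> (real \<Rightarrow> real \<Rightarrow> real^'m^'m) \<Rightarrow>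
   (real \<Rightarrow> 'm \<Rightarrow> 'b::real_normed_vector) \<Rightarrow> (real \<Rightarrow> 'm \<Rightarrow> 'm \<Rightarrow> 'b) \<Rightarrow> real \<Rightarrow> real \<Rightarrow> 'b \<Rightarrow> bool" where
  "rough_sums_converge W WW A A' a b L \<longleftrightarrow>
     (\<forall>\<epsilon>>0. \<exists>\<delta>>0. \<forall>n \<tau>. \<tau> 0 = a \<and> \<tau> n = b \<and>
        (\<forall>k<n. \<tau> k < \<tau> (Suc k) \<and> \<tau> (Suc k) - \<tau> k < \<delta>) \<longrightarrow>
        norm (rough_sum W WW A A' \<tau> n - L) < \<epsilon>)"

definition has_rough_integral ::
  "(real \<Rightarrow> real^'m) \<Rightarrow> (real \<Rightarrow> real \<Rightarrow> real^'m^'m) \<Rightarrow>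
   (real \<Rightarrow> 'm \<Rightarrow> 'b::real_normed_vector) \<Rightarrow> (real \<Rightarrow> 'm \<Rightarrow> 'm \<Rightarrow> 'b) \<Rightarrow> real \<Rightarrow> real \<Rightarrow> 'b \<Rightarrow> bool" where
  "has_rough_integral W WW A A' a b L \<longleftrightarrow>
     (if a \<le> b then rough_sums_converge W WW A A' a b L else rough_sums_converge W WW A A' b a (- L))"

definition rough_integral ::
  "(real \<Rightarrow> real^'m) \<Rightarrow> (real \<Rightarrow> real \<Rightarrow> real^'m^'m) \<Rightarrow>
   (real \<Rightarrow> 'm \<Rightarrow> 'b::real_normed_vector) \<Rightarrow> (real \<Rightarrow> 'm \<Rightarrow> 'm \<Rightarrow> 'b) \<Rightarrow> real \<Rightarrow> real \<Rightarrow> 'b" where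
  "rough_integral W WW A A' a b = (THE L. has_rough_integral W WW A A' a b L)"


section \<open>Characteristics and the solution operator\<close>

text \<open>\<open>H\<close> takes the pair \<open>(p, x)\<close>, whereas states of the characteristic system are pairs \<open>(x, p)\<close>.\<close>

type_synonym ('d, 'm) hamiltonian = "(real^'d) \<times> (real^'d) \<Rightarrow> real^'m"

definition DpH :: "('d::finite, 'm::finite) hamiltonian \<Rightarrow> 'm \<Rightarrow> real^'d \<Rightarrow> real^'d \<Rightarrow> real^'d" where
  "DpH H i p x = gradient (\<lambda>q. H (q, x) $ i) p"

definition DxH :: "('d::finite, 'm::finite) hamiltonian \<Rightarrow> 'm \<Rightarrow> real^'d \<Rightarrow> real^'d \<Rightarrow> real^'d" where
  "DxH H i p x = gradient (\<lambda>y. H (p, y) $ i) x"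

definition char_field ::
  "('d::finite, 'm::finite) hamiltonian \<Rightarrow> 'm \<Rightarrow> (real^'d) \<times> (real^'d) \<Rightarrow> (real^'d) \<times> (real^'d)" where
  "char_field H i y = (case y of (x, p) \<Rightarrow> (- DpH H i p x, DxH H i p x))"

definition action_rate ::
  "('d::finite, 'm::finite) hamiltonian \<Rightarrow> 'm \<Rightarrow> (real^'d) \<times> (real^'d) \<Rightarrow> real" where
  "action_rate H i y = (case y of (x, p) \<Rightarrow> H (p, x) $ i - p \<bullet> DpH H i p x)"

text \<open>If \<open>m = 1\<close>, the noise is scalar and the characteristics are a time change of an ordinary
  differential equation, whose solutions need not be global in \<open>\<tau>\<close>.\<close>

definition only_index :: "'m::finite" where
  "only_index = (THE i. True)"

definition increment1 :: "(real \<Rightarrow> real^'m) \<Rightarrow> real \<Rightarrow> real \<Rightarrow> real" where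
  "increment1 W t0 t = W t $ only_index - W t0 $ only_index"

definition ode_solution ::
  "('d::finite, 'm::finite) hamiltonian \<Rightarrow> (real^'d) \<times> (real^'d) \<Rightarrow> real \<Rightarrow>
   (real \<Rightarrow> (real^'d) \<times> (real^'d)) \<Rightarrow> bool" where
  "ode_solution H y0 \<tau> Y \<longleftrightarrow> Y 0 = y0 \<and>
     (\<forall>\<sigma>\<in>closed_segment 0 \<tau>.
        (Y has_vector_derivative char_field H only_index (Y \<sigma>)) (at \<sigma> within closed_segment 0 \<tau>))"

definition ode_flow ::
  "('d::finite, 'm::finite) hamiltonian \<Rightarrow> (real^'d) \<times> (real^'d) \<Rightarrow> real \<Rightarrow> (real^'d) \<times> (real^'d)" where
  "ode_flow H y0 \<tau> = (THE y. \<exists>Y. ode_solution H y0 \<tau> Y \<and> Y \<tau> = y)"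

text \<open>If \<open>m > 1\<close>, the characteristics solve a rough differential equation on \<open>[0, T]\<close>, started at
  time \<open>t0\<close>: the solution \<open>Y\<close> is controlled by \<open>W\<close> with Gubinelli derivative given by the vector
  fields along \<open>Y\<close>, and satisfies the integral equation.\<close>

definition gubinelli_along ::
  "('d::finite, 'm::finite) hamiltonian \<Rightarrow> ('m \<Rightarrow> (real^'d) \<times> (real^'d) \<Rightarrow> 'b::real_normed_vector) \<Rightarrow>
   (real \<Rightarrow> (real^'d) \<times> (real^'d)) \<Rightarrow> real \<Rightarrow> 'm \<Rightarrow> 'm \<Rightarrow> 'b" where
  "gubinelli_along H G Y s j i = frechet_derivative (G i) (at (Y s)) (char_field H j (Y s))"

definition rde_solution ::
  "real \<Rightarrow> ('d::finite, 'm::finite) hamiltonian \<Rightarrow> real \<Rightarrow> (real \<Rightarrow> real^'m) \<Rightarrow> (real \<Rightarrow> real \<Rightarrow> real^'m^'m) \<Rightarrow>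
   real \<Rightarrow> (real^'d) \<times> (real^'d) \<Rightarrow> (real \<Rightarrow> (real^'d) \<times> (real^'d)) \<Rightarrow> bool" where
  "rde_solution T H \<alpha> W WW t0 y0 Y \<longleftrightarrow>
     controlled_path T \<alpha> W Y (\<lambda>s j. char_field H j (Y s)) \<and>
     (\<forall>t\<in>{0..T}. has_rough_integral W WW
        (\<lambda>s i. char_field H i (Y s)) (gubinelli_along H (char_field H) Y) t0 t (Y t - y0))"

definition rde_flow ::
  "real \<Rightarrow> ('d::finite, 'm::finite) hamiltonian \<Rightarrow> real \<Rightarrow> (real \<Rightarrow> real^'m) \<Rightarrow> (real \<Rightarrow> real \<Rightarrow> real^'m^'m) \<Rightarrow>
   real \<Rightarrow> (real^'d) \<times> (real^'d) \<Rightarrow> real \<Rightarrow> (real^'d) \<times> (real^'d)" where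
  "rde_flow T H \<alpha> W WW t0 y0 t = (THE y. \<exists>Y. rde_solution T H \<alpha> W WW t0 y0 Y \<and> Y t = y)"

definition char_exists ::
  "real \<Rightarrow> ('d::finite, 'm::finite) hamiltonian \<Rightarrow> real \<Rightarrow> (real \<Rightarrow> real^'m) \<Rightarrow> (real \<Rightarrow> real \<Rightarrow> real^'m^'m) \<Rightarrow>
   real \<Rightarrow> (real^'d) \<times> (real^'d) \<Rightarrow> real \<Rightarrow> bool" where
  "char_exists T H \<alpha> W WW t0 y0 t \<longleftrightarrow>
     (if CARD('m) = 1 then \<exists>Y. ode_solution H y0 (increment1 W t0 t) Y
      else \<exists>Y. rde_solution T H \<alpha> W WW t0 y0 Y)"

definition char_flow ::
  "real \<Rightarrow> ('d::finite, 'm::finite) hamiltonian \<Rightarrow> real \<Rightarrow> (real \<Rightarrow> real^'m) \<Rightarrow> (real \<Rightarrow> real \<Rightarrow> real^'m^'m) \<Rightarrow>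
   real \<Rightarrow> (real^'d) \<times> (real^'d) \<Rightarrow> real \<Rightarrow> (real^'d) \<times> (real^'d)" where
  "char_flow T H \<alpha> W WW t0 y0 t =
     (if CARD('m) = 1 then ode_flow H y0 (increment1 W t0 t) else rde_flow T H \<alpha> W WW t0 y0 t)"

definition char_X ::
  "real \<Rightarrow> ('d::finite, 'm::finite) hamiltonian \<Rightarrow> real \<Rightarrow> (real \<Rightarrow> real^'m) \<Rightarrow> (real \<Rightarrow> real \<Rightarrow> real^'m^'m) \<Rightarrow>
   real \<Rightarrow> (real^'d \<Rightarrow> real) \<Rightarrow> real \<Rightarrow> real^'d \<Rightarrow> real^'d" where
  "char_X T H \<alpha> W WW t0 \<phi> t x = fst (char_flow T H \<alpha> W WW t0 (x, gradient \<phi> x) t)"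

definition char_Z ::
  "real \<Rightarrow> ('d::finite, 'm::finite) hamiltonian \<Rightarrow> real \<Rightarrow> (real \<Rightarrow> real^'m) \<Rightarrow> (real \<Rightarrow> real \<Rightarrow> real^'m^'m) \<Rightarrow>
   real \<Rightarrow> (real^'d \<Rightarrow> real) \<Rightarrow> real \<Rightarrow> real^'d \<Rightarrow> real" where
  "char_Z T H \<alpha> W WW t0 \<phi> t x = \<phi> x +
     (if CARD('m) = 1 then
        (LBINT \<tau>=ereal 0..ereal (increment1 W t0 t).
           action_rate H only_index (ode_flow H (x, gradient \<phi> x) \<tau>))
      else
        (let Y = rde_flow T H \<alpha> W WW t0 (x, gradient \<phi> x) in
         rough_integral W WW (\<lambda>s i. action_rate H i (Y s)) (gubinelli_along H (action_rate H) Y) t0 t))"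

definition solution_op ::
  "real \<Rightarrow> ('d::finite, 'm::finite) hamiltonian \<Rightarrow> real \<Rightarrow> (real \<Rightarrow> real^'m) \<Rightarrow> (real \<Rightarrow> real \<Rightarrow> real^'m^'m) \<Rightarrow>
   real \<Rightarrow> real \<Rightarrow> (real^'d \<Rightarrow> real) \<Rightarrow> real^'d \<Rightarrow> real" where
  "solution_op T H \<alpha> W WW t t0 \<phi> x =
     char_Z T H \<alpha> W WW t0 \<phi> t (inv (char_X T H \<alpha> W WW t0 \<phi> t) x)"

definition time_window :: "real \<Rightarrow> real \<Rightarrow> real \<Rightarrow> real set" where
  "time_window T t0 h = {t0 - h<..<t0 + h} \<inter> {0..T}"

text \<open>The meaning of ``\<open>S(t, t0) \<phi>\<close> is of class \<open>C\<^sup>2\<^sub>b\<close> for \<open>t \<in> (t0 - h, t0 + h)\<close>'', which includes that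
  \<open>S(t, t0) \<phi>\<close> is well-defined there by the method of characteristics.\<close>

definition smooth_extension ::
  "real \<Rightarrow> ('d::finite, 'm::finite) hamiltonian \<Rightarrow> real \<Rightarrow> (real \<Rightarrow> real^'m) \<Rightarrow> (real \<Rightarrow> real \<Rightarrow> real^'m^'m) \<Rightarrow>
   real \<Rightarrow> real \<Rightarrow> (real^'d \<Rightarrow> real) \<Rightarrow> bool" where
  "smooth_extension T H \<alpha> W WW t0 h \<phi> \<longleftrightarrow>
     (let J = time_window T t0 h; X = char_X T H \<alpha> W WW t0 \<phi> in
      (\<forall>t\<in>J. (\<forall>x. char_exists T H \<alpha> W WW t0 (x, gradient \<phi> x) t) \<and>
              bij (X t) \<and> C1_bounded_deriv (X t) \<and> C1_bounded_deriv (inv (X t)) \<and>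
              Ckb 2 UNIV (solution_op T H \<alpha> W WW t t0 \<phi>)) \<and>
      continuous_on (UNIV \<times> J) (\<lambda>(x, t). X t x) \<and>
      continuous_on (UNIV \<times> J) (\<lambda>(x, t). inv (X t) x))"


section \<open>Pathwise viscosity solutions\<close>

type_synonym 'd nonlinearity = "real^'d^'d \<Rightarrow> real^'d \<Rightarrow> real \<Rightarrow> real^'d \<Rightarrow> real \<Rightarrow> real"

text \<open>Functions on \<open>\<real>\<^sup>d \<times> [0, T]\<close> are represented by total functions of which only the values on
  this set matter. The next two predicates are the parts of the definitions of sub- and
  super-solutions which do not involve the initial datum; the comparison principle is stated
  for them, since it compares functions with different initial values.\<close>

definition eq_subsolution ::
  "real \<Rightarrow> 'd nonlinearity \<Rightarrow> ('d::finite, 'm::finite) hamiltonian \<Rightarrow> real \<Rightarrow> (real \<Rightarrow> real^'m) \<Rightarrow>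
   (real \<Rightarrow> real \<Rightarrow> real^'m^'m) \<Rightarrow> ((real^'d) \<times> real \<Rightarrow> real) \<Rightarrow> bool" where
  "eq_subsolution T F H \<alpha> W WW u \<longleftrightarrow>
     usc_on (UNIV \<times> {0..T}) u \<and> bdd_above (u ` (UNIV \<times> {0..T})) \<and>
     (\<forall>t0\<in>{0<..T}. \<forall>x0 \<phi> \<psi> \<psi>' h.
        Ckb 2 UNIV \<phi> \<and>
        (\<forall>t\<in>{0..T}. (\<psi> has_real_derivative \<psi>' t) (at t within {0..T})) \<and> continuous_on {0..T} \<psi>' \<and>
        h > 0 \<and> smooth_extension T H \<alpha> W WW t0 h \<phi> \<and>
        local_max_on (UNIV \<times> time_window T t0 h)
          (\<lambda>(x, t). u (x, t) - solution_op T H \<alpha> W WW t t0 \<phi> x - \<psi> t) (x0, t0) \<longrightarrow>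
        \<psi>' t0 \<le> F (hessian \<phi> x0) (gradient \<phi> x0) (u (x0, t0)) x0 t0)"

definition eq_supersolution ::
  "real \<Rightarrow> 'd nonlinearity \<Rightarrow> ('d::finite, 'm::finite) hamiltonian \<Rightarrow> real \<Rightarrow> (real \<Rightarrow> real^'m) \<Rightarrow>
   (real \<Rightarrow> real \<Rightarrow> real^'m^'m) \<Rightarrow> ((real^'d) \<times> real \<Rightarrow> real) \<Rightarrow> bool" where
  "eq_supersolution T F H \<alpha> W WW u \<longleftrightarrow>
     lsc_on (UNIV \<times> {0..T}) u \<and> bdd_below (u ` (UNIV \<times> {0..T})) \<and>
     (\<forall>t0\<in>{0<..T}. \<forall>x0 \<phi> \<psi> \<psi>' h.
        Ckb 2 UNIV \<phi> \<and>
        (\<forall>t\<in>{0..T}. (\<psi> has_real_derivative \<psi>' t) (at t within {0..T})) \<and> continuous_on {0..T} \<psi>' \<and>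
        h > 0 \<and> smooth_extension T H \<alpha> W WW t0 h \<phi> \<and>
        local_min_on (UNIV \<times> time_window T t0 h)
          (\<lambda>(x, t). u (x, t) - solution_op T H \<alpha> W WW t t0 \<phi> x - \<psi> t) (x0, t0) \<longrightarrow>
        \<psi>' t0 \<ge> F (hessian \<phi> x0) (gradient \<phi> x0) (u (x0, t0)) x0 t0)"

definition subsolution ::
  "real \<Rightarrow> 'd nonlinearity \<Rightarrow> ('d::finite, 'm::finite) hamiltonian \<Rightarrow> real \<Rightarrow> (real \<Rightarrow> real^'m) \<Rightarrow>
   (real \<Rightarrow> real \<Rightarrow> real^'m^'m) \<Rightarrow> (real^'d \<Rightarrow> real) \<Rightarrow> ((real^'d) \<times> real \<Rightarrow> real) \<Rightarrow> bool" where
  "subsolution T F H \<alpha> W WW u0 u \<longleftrightarrow> eq_subsolution T F H \<alpha> W WW u \<and> (\<forall>x. u (x, 0) \<le> u0 x)"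

definition supersolution ::
  "real \<Rightarrow> 'd nonlinearity \<Rightarrow> ('d::finite, 'm::finite) hamiltonian \<Rightarrow> real \<Rightarrow> (real \<Rightarrow> real^'m) \<Rightarrow>
   (real \<Rightarrow> real \<Rightarrow> real^'m^'m) \<Rightarrow> (real^'d \<Rightarrow> real) \<Rightarrow> ((real^'d) \<times> real \<Rightarrow> real) \<Rightarrow> bool" where
  "supersolution T F H \<alpha> W WW u0 u \<longleftrightarrow> eq_supersolution T F H \<alpha> W WW u \<and> (\<forall>x. u (x, 0) \<ge> u0 x)"

definition solution ::
  "real \<Rightarrow> 'd nonlinearity \<Rightarrow> ('d::finite, 'm::finite) hamiltonian \<Rightarrow> real \<Rightarrow> (real \<Rightarrow> real^'m) \<Rightarrow>
   (real \<Rightarrow> real \<Rightarrow> real^'m^'m) \<Rightarrow> (real^'d \<Rightarrow> real) \<Rightarrow> ((real^'d) \<times> real \<Rightarrow> real) \<Rightarrow> bool" where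
  "solution T F H \<alpha> W WW u0 u \<longleftrightarrow> subsolution T F H \<alpha> W WW u0 u \<and> supersolution T F H \<alpha> W WW u0 u"

definition maximal_subsolution ::
  "real \<Rightarrow> 'd nonlinearity \<Rightarrow> ('d::finite, 'm::finite) hamiltonian \<Rightarrow> real \<Rightarrow> (real \<Rightarrow> real^'m) \<Rightarrow>
   (real \<Rightarrow> real \<Rightarrow> real^'m^'m) \<Rightarrow> (real^'d \<Rightarrow> real) \<Rightarrow> ((real^'d) \<times> real \<Rightarrow> real) \<Rightarrow> bool" where
  "maximal_subsolution T F H \<alpha> W WW u0 u \<longleftrightarrow> subsolution T F H \<alpha> W WW u0 u \<and>
     (\<forall>v. subsolution T F H \<alpha> W WW u0 v \<longrightarrow> (\<forall>z\<in>UNIV \<times> {0..T}. v z \<le> u z))"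

definition minimal_supersolution ::
  "real \<Rightarrow> 'd nonlinearity \<Rightarrow> ('d::finite, 'm::finite) hamiltonian \<Rightarrow> real \<Rightarrow> (real \<Rightarrow> real^'m) \<Rightarrow>
   (real \<Rightarrow> real \<Rightarrow> real^'m^'m) \<Rightarrow> (real^'d \<Rightarrow> real) \<Rightarrow> ((real^'d) \<times> real \<Rightarrow> real) \<Rightarrow> bool" where
  "minimal_supersolution T F H \<alpha> W WW u0 u \<longleftrightarrow> supersolution T F H \<alpha> W WW u0 u \<and>
     (\<forall>v. supersolution T F H \<alpha> W WW u0 v \<longrightarrow> (\<forall>z\<in>UNIV \<times> {0..T}. u z \<le> v z))"


section \<open>Standing assumptions\<close>

definition F_assumption :: "real \<Rightarrow> ('d::finite) nonlinearity \<Rightarrow> bool" where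
  "F_assumption T F \<longleftrightarrow>
     continuous_on (sym_matrices \<times> UNIV \<times> UNIV \<times> UNIV \<times> {0..T}) (\<lambda>(X, p, r, x, t). F X p r x t) \<and>
     (\<forall>B \<subseteq> sym_matrices \<times> UNIV \<times> UNIV. bounded B \<longrightarrow>
        bounded ((\<lambda>((X, p, r), x, t). F X p r x t) ` (B \<times> UNIV \<times> {0..T}))) \<and>
     (\<forall>X\<in>sym_matrices. \<forall>Y\<in>sym_matrices. \<forall>p r x. \<forall>t\<in>{0..T}.
        matrix_le X Y \<longrightarrow> F X p r x t \<le> F Y p r x t) \<and>
     (\<forall>X\<in>sym_matrices. \<forall>p r s x. \<forall>t\<in>{0..T}. r \<le> s \<longrightarrow> F X p s x t \<le> F X p r x t)"

definition H_assumption :: "('d::finite, 'm::finite) hamiltonian \<Rightarrow> bool" where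
  "H_assumption H \<longleftrightarrow>
     (if CARD('m) = 1 then \<forall>R>0. Ckb 2 (ball 0 R \<times> UNIV) H else Ckb 4 UNIV H)"

text \<open>For \<open>m = 1\<close>, \<open>\<alpha>\<close> and \<open>WW\<close> are unconstrained; no definition above depends on them in this case.\<close>

definition W_assumption ::
  "real \<Rightarrow> real \<Rightarrow> (real \<Rightarrow> real^'m::finite) \<Rightarrow> (real \<Rightarrow> real \<Rightarrow> real^'m^'m) \<Rightarrow> bool" where
  "W_assumption T \<alpha> W WW \<longleftrightarrow> continuous_on {0..T} W \<and> W 0 = 0 \<and>
     (CARD('m) > 1 \<longrightarrow> 1/3 < \<alpha> \<and> \<alpha> \<le> 1/2 \<and> geometric_rough_path T \<alpha> W WW)"

definition comparison_principle ::
  "real \<Rightarrow> 'd nonlinearity \<Rightarrow> ('d::finite, 'm::finite) hamiltonian \<Rightarrow> real \<Rightarrow> (real \<Rightarrow> real^'m) \<Rightarrow>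
   (real \<Rightarrow> real \<Rightarrow> real^'m^'m) \<Rightarrow> bool" where
  "comparison_principle T F H \<alpha> W WW \<longleftrightarrow>
     (\<forall>u v. eq_subsolution T F H \<alpha> W WW u \<and> eq_supersolution T F H \<alpha> W WW v \<longrightarrow>
        (\<forall>t\<in>{0<..T}. (SUP x. max 0 (u (x, t) - v (x, t))) \<le> (SUP x. max 0 (u (x, 0) - v (x, 0)))))"

end

theory Submission
  imports Defs
begin

text \<open>At time 0 a sub-solution lies below \<open>u0\<close> and a super-solution above it, so
  the positive part of their difference vanishes initially, and comparison keeps it zero:
  \<open>subsolution_le_supersolution\<close>. A solution belongs to both classes. Hence it
  dominates every sub-solution, lies below every super-solution, and any two solutions dominate each
  other.\<close>

lemma subsolution_le_supersolution:
  fixes H :: "('d::finite, 'm::finite) hamiltonian"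
  assumes comp: "comparison_principle T F H \<alpha> W WW"
    and v: "subsolution T F H \<alpha> W WW u0 v"
    and w: "supersolution T F H \<alpha> W WW u0 w"
    and t: "t \<in> {0..T}"
  shows "v (x, t) \<le> w (x, t)"
proof -
  have initial: "v (y, 0) \<le> w (y, 0)" for y
    using v w unfolding subsolution_def supersolution_def by (meson order_trans)
  show ?thesis
  \<comment> \<open>The comparison principle speaks of positive times only; at time 0 the order of
    the initial values is the claim.\<close>
  proof (cases "t = 0")
    case True
    then show ?thesis using initial by simp
  next
    case False
    obtain a where a: "\<And>y. v (y, t) \<le> a"
      using v t unfolding subsolution_def eq_subsolution_def bdd_above_def by blast
    obtain b where b: "\<And>y. b \<le> w (y, t)"
      using w t unfolding supersolution_def eq_supersolution_def bdd_below_def by blast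
    \<comment> \<open>The one-sided bounds make the real-valued supremum at time \<open>t\<close> a genuine one.\<close>
    have "bdd_above (range (\<lambda>y. max 0 (v (y, t) - w (y, t))))"
    proof (rule bdd_aboveI2)
      show "max 0 (v (y, t) - w (y, t)) \<le> max 0 (a - b)" for y
        using a[of y] b[of y] by linarith
    qed
    then have "max 0 (v (x, t) - w (x, t)) \<le> (SUP y. max 0 (v (y, t) - w (y, t)))"
      by (rule cSUP_upper2[OF _ UNIV_I order_refl])
    also have "\<dots> \<le> (SUP y. max 0 (v (y, 0) - w (y, 0)))"
      using comp v w t False
      unfolding comparison_principle_def subsolution_def supersolution_def by simp
    \<comment> \<open>By \<open>initial\<close> each term is the positive part of a nonpositive
      number, so the supremum is that of the constant 0.\<close>
    also have "\<dots> = 0"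
      using initial by (simp add: max_absorb1)
    finally show ?thesis by linarith
  qed
qed

theorem mainTheorem2:
  fixes T \<alpha> :: real
    and F :: "('d::finite) nonlinearity"
    and H :: "('d, 'm::finite) hamiltonian"
    and W :: "real \<Rightarrow> real^'m"
    and WW :: "real \<Rightarrow> real \<Rightarrow> real^'m^'m"
    and u0 :: "real^'d \<Rightarrow> real"
  assumes "T > 0"
    and "F_assumption T F"
    and "H_assumption H"
    and "W_assumption T \<alpha> W WW"
    and "comparison_principle T F H \<alpha> W WW"
    and "BUC UNIV u0"
  shows "(\<forall>u v. solution T F H \<alpha> W WW u0 u \<and> BUC (UNIV \<times> {0..T}) u \<and>
                solution T F H \<alpha> W WW u0 v \<and> BUC (UNIV \<times> {0..T}) v \<longrightarrow>
                (\<forall>z\<in>UNIV \<times> {0..T}. u z = v z)) \<and>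
         (\<forall>u. solution T F H \<alpha> W WW u0 u \<and> BUC (UNIV \<times> {0..T}) u \<longrightarrow>
                maximal_subsolution T F H \<alpha> W WW u0 u \<and> minimal_supersolution T F H \<alpha> W WW u0 u)"
proof -
  have le: "v z \<le> w z"
    if "subsolution T F H \<alpha> W WW u0 v" "supersolution T F H \<alpha> W WW u0 w" "z \<in> UNIV \<times> {0..T}"
    for v w z
    using subsolution_le_supersolution[OF assms(5)] that by force
  show ?thesis
    unfolding maximal_subsolution_def minimal_supersolution_def solution_def
    \<comment> \<open>Uniqueness uses \<open>le\<close> twice, each solution serving once as sub-
      and once as super-solution; each extremality claim uses it once.\<close>
    using le by (blast intro: antisym)
qed

end
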